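(* Let $X$ be a real or complex Banach space, let $A:\mathbb{N}\to\mathcal{B}(X)$ be any sequence, and consider the linear discrete-time system $x_{n+1}=A(n)x_n$ with associated operators $A_m^n$, $(m,n)\in\Delta$. The following assertions are equivalent: (i) the system is uniformly exponentially stable; (ii) there are constants $D\ge1$ and $d>0$ such that $\sum_{m=n}^{\infty}e^{d(m-n)}\|A_m^p x\|\le D\|A_n^p x\|$ for all $(n,p)\in\Delta$ and $x\in X$; (iii) there exists a constant $D\ge1$ such that $\sum_{m=n}^{\infty}\|A_m^p x\|\le D\|A_n^p x\|$ for all $(n,p)\in\Delta$ and $x\in X$; (iv) there exists a constant $D\ge1$ such that $\sum_{m=n}^{\infty}\|A_m^n x\|\le D\|x\|$ for all $n\in\mathbb{N}$ and $x\in X$.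
   Context: $\mathbb{N}=\{0,1,2,\dots\}$. $\mathcal{B}(X)$ is the Banach algebra of bounded linear operators on $X$, and $I$ is the identity operator. $\Delta$ is the set of pairs $(m,n)$ of nonnegative integers with $m\ge n$. $T$ is the set of triples $(m,n,p)$ of nonnegative integers with $(m,n)\in\Delta$ and $(n,p)\in\Delta$. For $(m,n)\in\Delta$, $A_m^n=A(m)A(m-1)\cdots A(n+1)$ if $m\ge n+1$, and $A_m^n=I$ if $m=n$. An inequality bounding an infinite series of nonnegative terms includes the assertion that the series converges. The system is uniformly exponentially stable if there are constants $N\ge1$ and $\alpha>0$ such that $\|A_m^p x\|\le N e^{-\alpha(m-n)}\|A_n^p x\|$ for all $(m,n,p)\in T$ and $x\in X$. *)

theory Defs
  imports "HOL-Analysis.Analysis"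
begin

text \<open>
  The state space is a type of class \<open>banach\<close> and \<open>\<B>(X)\<close> is the type \<open>'a \<Rightarrow>\<^sub>L 'a\<close>, so scalars
  are real. Complex Banach spaces are covered by restriction of scalars: a complex Banach space
  is a real one under the same norm, a complex-linear bounded operator is real-linear and bounded,
  and nothing below refers to the scalar field otherwise.
\<close>

definition Delta :: "(nat \<times> nat) set" where
  "Delta = {(m, n). m \<ge> n}"

definition Triples :: "(nat \<times> nat \<times> nat) set" where
  "Triples = {(m, n, p). (m, n) \<in> Delta \<and> (n, p) \<in> Delta}"

text \<open>
  \<open>evol A m n\<close> is \<open>A\<^sub>m\<^sup>n = A(m) A(m-1) \<dots> A(n+1)\<close>, the identity for \<open>m = n\<close>. The value for
  \<open>m < n\<close>, i.e. outside \<open>Delta\<close>, is the identity by convention and is never used.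
\<close>

primrec evol :: "(nat \<Rightarrow> 'a::banach \<Rightarrow>\<^sub>L 'a) \<Rightarrow> nat \<Rightarrow> nat \<Rightarrow> 'a \<Rightarrow>\<^sub>L 'a" where
  "evol A 0 n = id_blinfun"
| "evol A (Suc m) n = (if Suc m \<ge> n + 1 then A (Suc m) o\<^sub>L evol A m n else id_blinfun)"

lemma evol_refl: "evol A n n = id_blinfun"
  by (cases n) simp_all

lemma evol_step: "m \<ge> n + 1 \<Longrightarrow> evol A m n = A m o\<^sub>L evol A (m - 1) n"
  by (cases m) simp_all

definition uniformly_exponentially_stable :: "(nat \<Rightarrow> 'a::banach \<Rightarrow>\<^sub>L 'a) \<Rightarrow> bool" where
  "uniformly_exponentially_stable A \<longleftrightarrow>
     (\<exists>N \<alpha> :: real. N \<ge> 1 \<and> \<alpha> > 0 \<and>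
        (\<forall>(m, n, p) \<in> Triples. \<forall>x.
           norm (evol A m p x) \<le> N * exp (- \<alpha> * (real m - real n)) * norm (evol A n p x)))"

text \<open>
  \<open>series_le f n B\<close>: the series of the \<open>f m\<close> over \<open>m \<ge> n\<close> converges and its sum is at most \<open>B\<close>.
  Convergence must be demanded separately since \<open>infsum\<close> is 0 on non-summable families. It is
  used only for nonnegative terms, where unconditional and ordinary convergence coincide.
\<close>

definition series_le :: "(nat \<Rightarrow> real) \<Rightarrow> nat \<Rightarrow> real \<Rightarrow> bool" where
  "series_le f n B \<longleftrightarrow> f summable_on {n..} \<and> infsum f {n..} \<le> B"

end

theory Submission
  imports Defs
begin

text \<open>
  The substance is that summability yields decay. If the tail sums \<open>S m = (\<Sum>k\<ge>m. a k)\<close> of a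
  nonnegative sequence satisfy \<open>S m \<le> D * a m\<close>, then \<open>S (m + 1) = S m - a m \<le> (1 - 1/D) * S m\<close>,
  so \<open>S\<close>, and with it \<open>a \<le> S\<close>, decays geometrically. This is applied to \<open>a m = \<parallel>A\<^sub>m\<^sup>p x\<parallel>\<close>; the
  cocycle identity \<open>A\<^sub>m\<^sup>p = A\<^sub>m\<^sup>n A\<^sub>n\<^sup>p\<close> reduces (iii) to its instance \<open>p = n\<close>, which is (iv).
\<close>

lemma evol_cocycle:
  assumes "p \<le> n" "n \<le> m"
  shows "evol A m p x = evol A m n (evol A n p x)"
  using assms(2)
proof (induction m rule: dec_induct)
  case base
  show ?case by (simp add: evol_refl)
next
  case (step m)
  \<comment> \<open>Since \<open>p \<le> n\<close> and \<open>n \<le> m\<close>, both sides unfold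
    through the product branch of \<open>evol\<close>.\<close>
  then show ?case using assms(1) by simp
qed

lemma infsum_atLeast_Suc:
  fixes a :: "nat \<Rightarrow> real"
  assumes "a summable_on {m..}"
  shows "infsum a {m..} = a m + infsum a {Suc m..}"
proof -
  have "a summable_on {Suc m..}"
    using assms by (rule summable_on_subset_banach) auto
  moreover have "{m..} = insert m {Suc m..}" by auto
  ultimately show ?thesis by (simp add: infsum_insert)
qed

lemma geometric_decay_of_tail_bound:
  fixes a :: "nat \<Rightarrow> real"
  assumes nonneg: "\<And>k. a k \<ge> 0" and D: "D \<ge> 1"
    and tail: "\<And>m. n \<le> m \<Longrightarrow> series_le a m (D * a m)"
    and "n \<le> m"
  shows "a m \<le> D * (1 - 1 / D) ^ (m - n) * a n"
proof -
  let ?S = "\<lambda>m. infsum a {m..}"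
  have summ: "a summable_on {m..}" and le: "?S m \<le> D * a m" if "n \<le> m" for m
    using tail[OF that] by (auto simp: series_le_def)
  have "?S m \<le> (1 - 1 / D) ^ (m - n) * ?S n"
    using \<open>n \<le> m\<close>
  proof (induction m rule: dec_induct)
    case base
    show ?case by simp
  next
    case (step m)
    have "?S (Suc m) = ?S m - a m"
      using infsum_atLeast_Suc[OF summ[OF step(1)]] by simp
    also have "\<dots> \<le> (1 - 1 / D) * ?S m"
      using le[OF step(1)] D by (simp add: field_simps)
    \<comment> \<open>The ratio is nonnegative because \<open>D \<ge> 1\<close>, so the induction
      hypothesis may be multiplied by it.\<close>
    also have "\<dots> \<le> (1 - 1 / D) * ((1 - 1 / D) ^ (m - n) * ?S n)"
      using step.IH D by (intro mult_left_mono) auto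
    finally show ?case using step(1) by (simp add: Suc_diff_le mult.assoc)
  qed
  \<comment> \<open>The tail bound at \<open>n\<close> returns from sums to terms; this is the
    source of the leading factor \<open>D\<close>.\<close>
  also have "\<dots> \<le> (1 - 1 / D) ^ (m - n) * (D * a n)"
    using le[of n] D by (intro mult_left_mono) auto
  finally have "?S m \<le> D * (1 - 1 / D) ^ (m - n) * a n" by (simp add: mult_ac)
  moreover have "a m \<le> ?S m"
    using infsum_atLeast_Suc[OF summ[OF \<open>n \<le> m\<close>]] infsum_nonneg[of "{Suc m..}" a] nonneg
    by simp
  ultimately show ?thesis by simp
qed

text \<open>The shift by \<open>n\<close> carries this to the usual geometric series. It supplies
  the dominating series for the weighted sums of a stable system.\<close>

lemma has_sum_geometric_atLeast:
  fixes r :: real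
  assumes "0 \<le> r" "r < 1"
  shows "((\<lambda>m. r ^ (m - n)) has_sum 1 / (1 - r)) {n..}"
proof -
  have "(\<lambda>k. r ^ k) sums (1 / (1 - r))"
    using assms by (intro geometric_sums) simp
  then have "((\<lambda>k. r ^ k) has_sum 1 / (1 - r)) UNIV"
    using assms by (intro sums_nonneg_imp_has_sum) auto
  moreover have "bij_betw (\<lambda>k. k + n) UNIV {n..}"
    by (rule bij_betw_byWitness[where f' = "\<lambda>m. m - n"]) auto
  ultimately show ?thesis
    using has_sum_reindex_bij_betw[of "\<lambda>k. k + n" UNIV "{n..}" "\<lambda>m. r ^ (m - n)" "1 / (1 - r)"] by simp
qed

text \<open>Comparison test: nonnegativity of \<open>f\<close> turns domination by \<open>g\<close>
  into convergence, which \<open>series_le\<close> asserts along with the bound.\<close>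

lemma series_le_mono:
  assumes "series_le g n B" "\<And>m. n \<le> m \<Longrightarrow> 0 \<le> f m" "\<And>m. n \<le> m \<Longrightarrow> f m \<le> g m" "B \<le> C"
  shows "series_le f n C"
proof -
  have g: "g summable_on {n..}" "infsum g {n..} \<le> B"
    using assms(1) by (auto simp: series_le_def)
  have f: "f summable_on {n..}"
    using g(1) by (rule summable_on_comparison_test) (use assms in auto)
  have "infsum f {n..} \<le> infsum g {n..}"
    using f g(1) by (rule infsum_mono) (use assms in auto)
  then show ?thesis using f g(2) assms(4) by (simp add: series_le_def)
qed

text \<open>The decay rate is split in half: the weight, with \<open>d = \<alpha> / 2\<close>,
  absorbs one half, and the other leaves a geometric series of ratio
  \<open>r = exp (- \<alpha> / 2)\<close>, whose sum gives \<open>D = N / (1 - r)\<close>.\<close>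

lemma stable_imp_weighted_series:
  assumes "uniformly_exponentially_stable A"
  shows "\<exists>D d :: real. D \<ge> 1 \<and> d > 0 \<and>
    (\<forall>(n, p) \<in> Delta. \<forall>x.
       series_le (\<lambda>m. exp (d * (real m - real n)) * norm (evol A m p x)) n
         (D * norm (evol A n p x)))"
proof -
  obtain N \<alpha> :: real where N: "N \<ge> 1" and \<alpha>: "\<alpha> > 0"
    and bound: "\<And>m n p x. p \<le> n \<Longrightarrow> n \<le> m \<Longrightarrow>
      norm (evol A m p x) \<le> N * exp (- \<alpha> * (real m - real n)) * norm (evol A n p x)"
    using assms unfolding uniformly_exponentially_stable_def Triples_def Delta_def by fastforce
  define r where "r = exp (- \<alpha> / 2)"
  have r: "0 \<le> r" "r < 1" using \<alpha> by (auto simp: r_def)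
  have "series_le (\<lambda>m. exp (\<alpha> / 2 * (real m - real n)) * norm (evol A m p x)) n
      (N / (1 - r) * norm (evol A n p x))" if "p \<le> n" for n p x
  proof (rule series_le_mono)
    let ?c = "N * norm (evol A n p x)"
    have "((\<lambda>m. ?c * r ^ (m - n)) has_sum ?c * (1 / (1 - r))) {n..}"
      by (intro has_sum_cmult_right has_sum_geometric_atLeast r)
    then show "series_le (\<lambda>m. ?c * r ^ (m - n)) n (?c * (1 / (1 - r)))"
      unfolding series_le_def using has_sum_imp_summable infsumI by fastforce
    show "exp (\<alpha> / 2 * (real m - real n)) * norm (evol A m p x) \<le> ?c * r ^ (m - n)"
      if "n \<le> m" for m
    proof -
      have "exp (\<alpha> / 2 * (real m - real n)) * norm (evol A m p x)
          \<le> exp (\<alpha> / 2 * (real m - real n)) *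
            (N * exp (- \<alpha> * (real m - real n)) * norm (evol A n p x))"
        using bound[OF \<open>p \<le> n\<close> that] by (intro mult_left_mono) auto
      also have "\<dots> = ?c * (exp (\<alpha> / 2 * (real m - real n)) * exp (- \<alpha> * (real m - real n)))"
        by (simp only: mult_ac)
      also have "exp (\<alpha> / 2 * (real m - real n)) * exp (- \<alpha> * (real m - real n)) = r ^ (m - n)"
        using that by (simp add: r_def of_nat_diff field_simps flip: exp_add exp_of_nat_mult)
      finally show ?thesis .
    qed
  qed (simp_all add: field_simps)
  moreover have "N / (1 - r) \<ge> 1" using N r by (simp add: field_simps)
  ultimately show ?thesis using \<alpha>
    by (intro exI[of _ "N / (1 - r)"] exI[of _ "\<alpha> / 2"]) (auto simp: Delta_def)
qed

text \<open>For \<open>k \<ge> n\<close>, the assumption started at \<open>k\<close> from the vector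
  \<open>evol A k p x\<close> is, by the cocycle identity, the tail bound at \<open>k\<close> for
  the norms along the orbit of \<open>x\<close>, so these decay geometrically.\<close>

lemma series_imp_stable:
  assumes "D \<ge> 1" and series: "\<And>n x. series_le (\<lambda>m. norm (evol A m n x)) n (D * norm x)"
  shows "uniformly_exponentially_stable A"
proof -
  \<comment> \<open>enlarging \<open>D\<close> makes the ratio \<open>1 - 1 / D\<close> positive, as needed for its logarithm\<close>
  define E where "E = D + 1"
  define q where "q = 1 - 1 / E"
  have E: "E \<ge> 1" and q: "0 < q" "q < 1"
    using \<open>D \<ge> 1\<close> by (auto simp: E_def q_def field_simps)
  have "norm (evol A m p x) \<le> E * exp (- (- ln q) * (real m - real n)) * norm (evol A n p x)"
    if "p \<le> n" "n \<le> m" for m n p x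
  proof -
    have "norm (evol A m p x) \<le> E * (1 - 1 / E) ^ (m - n) * norm (evol A n p x)"
    proof (rule geometric_decay_of_tail_bound[OF _ E _ \<open>n \<le> m\<close>])
      fix k assume "n \<le> k"
      then have "p \<le> k" using that by simp
      \<comment> \<open>An equality in fact, stated as the domination that
        \<open>series_le_mono\<close> takes.\<close>
      have "norm (evol A m p x) \<le> norm (evol A m k (evol A k p x))" if "k \<le> m" for m
        by (subst evol_cocycle[OF \<open>p \<le> k\<close> that]) simp
      then show "series_le (\<lambda>m. norm (evol A m p x)) k (E * norm (evol A k p x))"
        by (rule series_le_mono[OF series[of k "evol A k p x"] norm_ge_zero])
          (auto simp: E_def intro: mult_right_mono)
    qed simp
    \<comment> \<open>The geometric ratio \<open>q\<close> becomes the exponential rate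
      \<open>- ln q\<close>, positive since \<open>q < 1\<close>.\<close>
    also have "(1 - 1 / E) ^ (m - n) = exp (- (- ln q) * (real m - real n))"
      using q that by (simp add: exp_of_nat2_mult flip: q_def of_nat_diff)
    finally show ?thesis .
  qed
  moreover have "- ln q > 0" using q by simp
  ultimately show ?thesis
    unfolding uniformly_exponentially_stable_def Triples_def Delta_def using E
    by (intro exI[of _ E] exI[of _ "- ln q"]) auto
qed

theorem theorem2:
  fixes A :: "nat \<Rightarrow> 'a::banach \<Rightarrow>\<^sub>L 'a"
  shows
    "(uniformly_exponentially_stable A \<longleftrightarrow>
       (\<exists>D d :: real. D \<ge> 1 \<and> d > 0 \<and>
          (\<forall>(n, p) \<in> Delta. \<forall>x.
             series_le (\<lambda>m. exp (d * (real m - real n)) * norm (evol A m p x)) n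
               (D * norm (evol A n p x)))))
     \<and> (uniformly_exponentially_stable A \<longleftrightarrow>
       (\<exists>D :: real. D \<ge> 1 \<and>
          (\<forall>(n, p) \<in> Delta. \<forall>x.
             series_le (\<lambda>m. norm (evol A m p x)) n (D * norm (evol A n p x)))))
     \<and> (uniformly_exponentially_stable A \<longleftrightarrow>
       (\<exists>D :: real. D \<ge> 1 \<and>
          (\<forall>n x. series_le (\<lambda>m. norm (evol A m n x)) n (D * norm x))))"
proof -
  let ?i = "uniformly_exponentially_stable A"
  let ?ii = "\<exists>D d :: real. D \<ge> 1 \<and> d > 0 \<and> (\<forall>(n, p) \<in> Delta. \<forall>x.
    series_le (\<lambda>m. exp (d * (real m - real n)) * norm (evol A m p x)) n (D * norm (evol A n p x)))"
  let ?iii = "\<exists>D :: real. D \<ge> 1 \<and> (\<forall>(n, p) \<in> Delta. \<forall>x.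
    series_le (\<lambda>m. norm (evol A m p x)) n (D * norm (evol A n p x)))"
  let ?iv = "\<exists>D :: real. D \<ge> 1 \<and> (\<forall>n x. series_le (\<lambda>m. norm (evol A m n x)) n (D * norm x))"
  \<comment> \<open>The four assertions are linked in a cycle, which yields all three
    equivalences.\<close>
  have "?i \<Longrightarrow> ?ii" by (rule stable_imp_weighted_series)
  moreover have "?ii \<Longrightarrow> ?iii"
  proof -
    assume ?ii
    then obtain D d :: real where "D \<ge> 1" "d > 0"
      and weighted: "\<And>n p x. (n, p) \<in> Delta \<Longrightarrow>
        series_le (\<lambda>m. exp (d * (real m - real n)) * norm (evol A m p x)) n (D * norm (evol A n p x))"
      by blast
    \<comment> \<open>For \<open>m \<ge> n\<close> the weight is at least 1, so dropping it only
      shrinks the terms and the same \<open>D\<close> works.\<close>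
    have "series_le (\<lambda>m. norm (evol A m p x)) n (D * norm (evol A n p x))"
      if "(n, p) \<in> Delta" for n p x
      using weighted[OF that]
      by (rule series_le_mono) (use \<open>d > 0\<close> in \<open>auto simp: mult_le_cancel_right1\<close>)
    then show ?iii using \<open>D \<ge> 1\<close> by blast
  qed
  moreover have "?iii \<Longrightarrow> ?iv"
  proof -
    assume ?iii
    then obtain D :: real where "D \<ge> 1"
      and series: "\<And>n p x. (n, p) \<in> Delta \<Longrightarrow>
        series_le (\<lambda>m. norm (evol A m p x)) n (D * norm (evol A n p x))"
      by blast
    have "series_le (\<lambda>m. norm (evol A m n x)) n (D * norm x)" for n x
      using series[of n n x] by (simp add: Delta_def evol_refl)
    then show ?iv using \<open>D \<ge> 1\<close> by blast
  qed
  moreover have "?iv \<Longrightarrow> ?i" by (blast intro: series_imp_stable)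
  ultimately show ?thesis by argo
qed

end
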